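(* Let $q$ be an odd prime power and let $D,E\in\mathbb{F}_q$. Define $\omega=3D^2-3DE+E^2$ and consider $$f(X)=EX^2+2(E-D)X^{q+1}+2DX^{q^2+1}+(E-D)X^{2q}+DX^{2q^2}.$$ Then $f(X)$ is planar over $\mathbb{F}_{q^3}$ if and only if $E\omega\neq 0$.
   Context: For $q$ odd, a function $f:\mathbb{F}_{q^n}\to\mathbb{F}_{q^n}$ is called planar (over $\mathbb{F}_{q^n}$) if for every $\epsilon\in\mathbb{F}_{q^n}^*$ the polynomial $f(X+\epsilon)-f(X)$ induces a permutation of $\mathbb{F}_{q^n}$. *)

theory Defs
  imports "HOL-Number_Theory.Number_Theory" "HOL-Library.Cardinality"
begin

definition is_subfield :: "'a::field set \<Rightarrow> bool" where
  "is_subfield K \<longleftrightarrow>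
     0 \<in> K \<and> 1 \<in> K \<and>
     (\<forall>x\<in>K. \<forall>y\<in>K. x + y \<in> K) \<and> (\<forall>x\<in>K. - x \<in> K) \<and>
     (\<forall>x\<in>K. \<forall>y\<in>K. x * y \<in> K) \<and> (\<forall>x\<in>K. x \<noteq> 0 \<longrightarrow> inverse x \<in> K)"

(* The finite field over which planarity is considered is the whole type 'a. *)
definition planar :: "('a::{field,finite} \<Rightarrow> 'a) \<Rightarrow> bool" where
  "planar f \<longleftrightarrow> (\<forall>\<epsilon>. \<epsilon> \<noteq> 0 \<longrightarrow> bij (\<lambda>x. f (x + \<epsilon>) - f x))"

end

theory Submission
  imports Defs "HOL-Computational_Algebra.Polynomial"
begin

text \<open>
  Over the field of order \<open>q\<^sup>3\<close>, \<open>f\<close> is the composition of three maps: the bijection \<open>L(x) = x + x\<^sup>q\<close>, squaring,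
  and the \<open>q\<close>-linear map \<open>M(w) = (E - D) w + D w\<^bsup>q\<^sup>2\<^esup>\<close>. Squaring is planar in odd characteristic, so \<open>f\<close> is
  planar iff \<open>M\<close> is bijective. As \<open>w \<mapsto> w\<^bsup>q\<^sup>2\<^esup>\<close> has order 3 and fixes the coefficients,
  \<open>M\<close> is singular iff \<open>(E - D)\<^sup>3 + D\<^sup>3 = E \<omega>\<close> vanishes.
\<close>

text \<open>Multiplication by a nonzero \<open>x\<close> permutes \<open>K - {0}\<close>, so
  comparing products gives \<open>x ^ (card K - 1) = 1\<close>. Used with \<open>K = UNIV\<close>
  for the order of Frobenius and with \<open>Fq\<close> to fix the coefficients.\<close>

lemma subfield_power_card:
  fixes K :: "'a::{field,finite} set"
  assumes K: "is_subfield K" and x: "x \<in> K"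
  shows "x ^ card K = x"
proof (cases "x = 0")
  case True
  \<comment> \<open>Since \<open>0 ^ 0 = 1\<close>, the case \<open>x = 0\<close> needs a positive
    exponent.\<close>
  moreover have "card K > 0" using x by (auto simp: card_gt_0_iff)
  ultimately show ?thesis by (simp add: zero_power)
next
  case False
  have inv: "inverse x \<in> K" using K x False by (auto simp: is_subfield_def)
  have cl: "y * z \<in> K" if "y \<in> K" "z \<in> K" for y z
    using K that by (auto simp: is_subfield_def)
  have "0 \<in> K" using K by (simp add: is_subfield_def)
  have "(\<Prod>y\<in>K-{0}. x * y) = (\<Prod>y\<in>K-{0}. y)"
    by (rule prod.reindex_bij_witness[of _ "\<lambda>y. y * inverse x" "\<lambda>y. x * y"])
       (use False inv x cl in auto)
  hence "x ^ card (K - {0}) * \<Prod>(K - {0}) = \<Prod>(K - {0})"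
    by (simp add: prod.distrib)
  hence "x ^ card (K - {0}) = 1" by simp
  moreover have "card K = Suc (card (K - {0}))"
    using \<open>0 \<in> K\<close> by (metis card.remove finite)
  ultimately show ?thesis by simp
qed

lemma prime_CHAR_finite_field: "prime CHAR('a::{field,finite})"
  by (simp add: finite_imp_CHAR_pos prime_CHAR_semidom)

text \<open>The characteristic divides the order of the field, a power of \<open>p\<close>, so it
  equals \<open>p\<close>; hence \<open>q ^ m\<close> is a power of the characteristic.\<close>

lemma power_add_of_card_power:
  fixes x y :: "'a::{field,finite}"
  assumes "primepow q" and "CARD('a) = q ^ n"
  shows "(x + y) ^ (q ^ m) = x ^ (q ^ m) + y ^ (q ^ m)"
proof -
  obtain p k where p: "prime p" and q: "q = p ^ k"
    using assms(1) by (auto simp: primepow_def)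
  have "CHAR('a) dvd p ^ (k * n)"
    using CHAR_dvd_CARD[where 'a = 'a] by (simp add: assms(2) q power_mult)
  hence "CHAR('a) = p"
    using prime_CHAR_finite_field[where 'a = 'a] p prime_dvd_power primes_dvd_imp_eq by blast
  hence "q ^ m = CHAR('a) ^ (k * m)"
    by (simp add: q power_mult)
  thus ?thesis
    by (rule freshmans_dream'[OF prime_CHAR_finite_field])
qed

lemma two_neq_zero_of_odd_card:
  assumes "odd CARD('a::{field,finite})"
  shows "(2 :: 'a) \<noteq> 0"
proof
  assume "(2 :: 'a) = 0"
  hence "of_nat 2 = (0 :: 'a)" by simp
  hence "CHAR('a) dvd 2" by (simp only: of_nat_eq_0_iff_char_dvd)
  hence "CHAR('a) = 2"
    using prime_CHAR_finite_field[where 'a = 'a] two_is_prime_nat primes_dvd_imp_eq by blast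
  thus False using CHAR_dvd_CARD[where 'a = 'a] assms by simp
qed

lemma additive_bij_iff:
  fixes M :: "'a::{ab_group_add,finite} \<Rightarrow> 'a"
  assumes add: "\<And>x y. M (x + y) = M x + M y"
  shows "bij M \<longleftrightarrow> (\<forall>x. M x = 0 \<longrightarrow> x = 0)"
proof -
  have M0: "M 0 = 0" using add[of 0 0] by simp
  have diff: "M (x - y) = M x - M y" for x y
    using add[of "x - y" y] by (simp add: algebra_simps)
  have "inj M \<longleftrightarrow> (\<forall>x. M x = 0 \<longrightarrow> x = 0)"
  proof
    assume "inj M"
    thus "\<forall>x. M x = 0 \<longrightarrow> x = 0" using M0 by (metis injD)
  next
    assume *: "\<forall>x. M x = 0 \<longrightarrow> x = 0"
    show "inj M"
    proof (rule injI)
      fix x y assume "M x = M y"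
      hence "M (x - y) = 0" by (simp add: diff)
      thus "x = y" using * by (metis eq_iff_diff_eq_0)
    qed
  qed
  thus ?thesis by (metis bij_def finite_UNIV_inj_surj finite)
qed

text \<open>The difference map of \<open>F \<circ> L\<close> at \<open>e\<close> is that of
  \<open>F\<close> at \<open>L e\<close>, precomposed with \<open>L\<close>; and \<open>L\<close>
  permutes the nonzero elements.\<close>

lemma planar_comp_additive_bij:
  fixes L :: "'a::{field,finite} \<Rightarrow> 'a"
  assumes add: "\<And>x y. L (x + y) = L x + L y" and L: "bij L"
  shows "planar (\<lambda>x. F (L x)) \<longleftrightarrow> planar F"
proof -
  have step: "bij (\<lambda>x. F (L (x + e)) - F (L x)) \<longleftrightarrow> bij (\<lambda>x. F (x + L e) - F x)" for e
  proof -
    have "(\<lambda>x. F (L (x + e)) - F (L x)) = (\<lambda>x. F (x + L e) - F x) \<circ> L"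
      by (simp add: add fun_eq_iff)
    thus ?thesis using bij_betw_comp_iff[OF L] by metis
  qed
  have ker: "L e = 0 \<longleftrightarrow> e = 0" for e
  proof -
    have "L 0 = 0" using add[of 0 0] by (metis add_cancel_right_right)
    thus ?thesis using additive_bij_iff[of L, OF add] L by blast
  qed
  have "(\<forall>e. e \<noteq> 0 \<longrightarrow> P (L e)) \<longleftrightarrow> (\<forall>e. e \<noteq> 0 \<longrightarrow> P e)" for P
  proof
    assume *: "\<forall>e. e \<noteq> 0 \<longrightarrow> P (L e)"
    show "\<forall>e. e \<noteq> 0 \<longrightarrow> P e"
    proof (intro allI impI)
      fix e :: 'a assume "e \<noteq> 0"
      moreover obtain d where "e = L d" using L by (meson bij_pointE)
      ultimately show "P e" using * ker by blast
    qed
  qed (use ker in blast)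
  thus ?thesis unfolding planar_def step .
qed

text \<open>By additivity the difference map at \<open>e\<close> is \<open>M\<close> after the
  affine map \<open>2 * e * x + e ^ 2\<close>, which is bijective for every nonzero
  \<open>e\<close>.\<close>

lemma planar_additive_square_iff:
  fixes M :: "'a::{field,finite} \<Rightarrow> 'a"
  assumes two: "(2::'a) \<noteq> 0" and add: "\<And>x y. M (x + y) = M x + M y"
  shows "planar (\<lambda>x. M (x ^ 2)) \<longleftrightarrow> bij M"
proof -
  have affine: "bij (\<lambda>x. 2 * e * x + e ^ 2)" if "e \<noteq> 0" for e :: 'a
    by (rule bij_betw_byWitness[of _ "\<lambda>y. (y - e ^ 2) / (2 * e)"])
       (use two that in auto)
  have "M ((x + e) ^ 2) - M (x ^ 2) = M (2 * e * x + e ^ 2)" for x e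
    using add[of "x ^ 2" "2 * e * x + e ^ 2"] by (simp add: power2_eq_square algebra_simps)
  hence step: "(\<lambda>x. M ((x + e) ^ 2) - M (x ^ 2)) = M \<circ> (\<lambda>x. 2 * e * x + e ^ 2)" for e
    by (simp add: fun_eq_iff)
  have "bij (\<lambda>x. M ((x + e) ^ 2) - M (x ^ 2)) \<longleftrightarrow> bij M" if "e \<noteq> 0" for e
    unfolding step using bij_betw_comp_iff[OF affine[OF that]] by metis
  \<comment> \<open>Planarity yields \<open>bij M\<close> through one nonzero shift,
    \<open>e = 1\<close>.\<close>
  thus ?thesis unfolding planar_def by (metis one_neq_zero)
qed

text \<open>A nonzero polynomial of degree below the order of the field cannot vanish everywhere;
  distinct exponents keep the three coefficients from merging.\<close>

lemma trinomial_nonvanishing: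
  fixes a b c :: "'a::{field,finite}"
  assumes "1 < m" "m < n" "n < CARD('a)" and "a \<noteq> 0 \<or> b \<noteq> 0 \<or> c \<noteq> 0"
  shows "\<exists>x. a * x + b * x ^ m + c * x ^ n \<noteq> 0"
proof (rule ccontr)
  define p where "p = Polynomial.monom a 1 + Polynomial.monom b m + Polynomial.monom c n"
  assume "\<not> ?thesis"
  hence "{x. poly p x = 0} = UNIV" by (simp add: p_def poly_monom)
  moreover have "p \<noteq> 0"
  proof
    assume "p = 0"
    hence "Polynomial.coeff p 1 = 0" "Polynomial.coeff p m = 0" "Polynomial.coeff p n = 0" by simp_all
    thus False using assms by (simp add: p_def)
  qed
  moreover have "Polynomial.degree p \<le> n"
    unfolding p_def by (intro degree_add_le degree_monom_le[THEN order_trans]) (use assms in auto)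
  ultimately show False using card_poly_roots_bound[of p] assms(3) by simp
qed

theorem theorem3p3:
  fixes q :: nat
    and Fq :: "'a::{field,finite} set"
    and D E \<omega> :: 'a
    and f :: "'a \<Rightarrow> 'a"
  assumes "primepow q" and "odd q"
    and "CARD('a) = q ^ 3"
    and "is_subfield Fq" and "card Fq = q"
    and "D \<in> Fq" and "E \<in> Fq"
    and "\<omega> = 3 * D ^ 2 - 3 * D * E + E ^ 2"
    and "f = (\<lambda>x. E * x ^ 2 + 2 * (E - D) * x ^ (q + 1) + 2 * D * x ^ (q ^ 2 + 1)
                 + (E - D) * x ^ (2 * q) + D * x ^ (2 * q ^ 2))"
  shows "planar f \<longleftrightarrow> E * \<omega> \<noteq> 0"
proof -
  define c where "c = E - D"
  define L where "L = (\<lambda>x::'a. x + x ^ q)"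
  define M where "M = (\<lambda>w. c * w + D * w ^ (q ^ 2))"
  have two: "(2::'a) \<noteq> 0"
    by (rule two_neq_zero_of_odd_card) (simp add: assms)
  have q1: "1 < q" using assms(1) primepow_gt_Suc_0 by auto
  have add: "(x + y) ^ (q ^ m) = x ^ (q ^ m) + y ^ (q ^ m)" for x y :: 'a and m
    by (rule power_add_of_card_power[OF assms(1,3)])
  have zero: "(0::'a) ^ (q ^ 2) = 0" using q1 by (simp add: power_0_left)
  have add1: "(x + y) ^ q = x ^ q + y ^ q" for x y :: 'a
    using add[of x y 1] by simp
  have cube: "x ^ (q ^ 3) = x" for x :: 'a
    using subfield_power_card[of UNIV x] by (simp add: assms(3) is_subfield_def)
  have q2q: "(x ^ (q ^ 2)) ^ q = x" "(x ^ q) ^ (q ^ 2) = x" for x :: 'a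
    using cube[of x] by (simp_all flip: power_mult power_Suc power_Suc2 add: eval_nat_numeral)
  have q2q2: "(x ^ (q ^ 2)) ^ (q ^ 2) = x ^ q" for x :: 'a
    using q2q(1)[of x] by (metis power2_eq_square power_mult)
  have fixed: "x ^ (q ^ 2) = x" if "x \<in> Fq" for x
    using subfield_power_card[OF assms(4) that] assms(5) by (metis power2_eq_square power_mult)
  have "c \<in> Fq"
    using assms(4,6,7) unfolding c_def is_subfield_def by (metis add_uminus_conv_diff)
  note fixed_c = fixed[OF this] and fixed_D = fixed[OF assms(6)]

  have L_add: "L (x + y) = L x + L y" for x y by (simp add: L_def add1)
  have M_add: "M (x + y) = M x + M y" for x y by (simp add: M_def add algebra_simps)

  have "x = 0" if "L x = 0" for x
  proof -
    have xq: "x ^ q = - x" using that by (simp add: L_def eq_neg_iff_add_eq_0 add.commute)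
    \<comment> \<open>Each of the three odd powers flips the sign, while together they are the
      identity.\<close>
    hence "((x ^ q) ^ q) ^ q = - x"
      using \<open>odd q\<close> by simp
    moreover have "((x ^ q) ^ q) ^ q = x"
      using cube[of x] by (simp add: power3_eq_cube power_mult)
    ultimately have "x + x = 0" by (metis add.right_inverse)
    hence "2 * x = 0" by simp
    thus ?thesis using two by simp
  qed
  hence L_bij: "bij L" using additive_bij_iff[of L, OF L_add] by blast

  have "f x = M (L x ^ 2)" for x
  proof -
    \<comment> \<open>With \<open>c + D = E\<close>, expanding
      \<open>c * (x + x ^ q) ^ 2 + D * (x ^ (q ^ 2) + x) ^ 2\<close> gives the five terms of
      \<open>f\<close>.\<close>
    have "(L x ^ 2) ^ (q ^ 2) = (L x ^ (q ^ 2)) ^ 2" by (metis power_mult mult.commute)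
    also have "L x ^ (q ^ 2) = x ^ (q ^ 2) + x" by (simp add: L_def add q2q)
    finally show ?thesis
      unfolding assms(9) M_def L_def c_def power_add power_one_right
        mult.commute[of 2] power_mult
      by (simp add: algebra_simps power2_eq_square)
  qed
  hence "planar f \<longleftrightarrow> planar (\<lambda>x. M (L x ^ 2))" by presburger
  also have "\<dots> \<longleftrightarrow> planar (\<lambda>x. M (x ^ 2))"
    by (rule planar_comp_additive_bij[of L, OF L_add L_bij])
  also have "\<dots> \<longleftrightarrow> bij M" by (rule planar_additive_square_iff[of M, OF two M_add])
  also have "\<dots> \<longleftrightarrow> (\<forall>w. M w = 0 \<longrightarrow> w = 0)"
    by (rule additive_bij_iff[of M, OF M_add])
  also have "\<dots> \<longleftrightarrow> c ^ 3 + D ^ 3 \<noteq> 0"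
  proof
    assume det: "c ^ 3 + D ^ 3 \<noteq> 0"
    show "\<forall>w. M w = 0 \<longrightarrow> w = 0"
    proof (intro allI impI)
      fix w assume Mw: "M w = 0"
      \<comment> \<open>Conjugating \<open>M w = 0\<close> twice gives a circulant linear system in
        \<open>w\<close>, \<open>u\<close>, \<open>v\<close> with determinant
        \<open>c ^ 3 + D ^ 3\<close>.\<close>
      define u v where "u = w ^ (q ^ 2)" and "v = w ^ q"
      have frob: "M w ^ (q ^ 2) = c * u + D * v"
        by (simp add: M_def u_def v_def add power_mult_distrib fixed_c fixed_D q2q2)
      have 1: "c * w + D * u = 0" using Mw by (simp add: M_def u_def)
      have 2: "c * u + D * v = 0"
        using frob Mw zero by simp
      have "(c * u + D * v) ^ (q ^ 2) = c * v + D * w"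
        by (simp add: u_def v_def add power_mult_distrib fixed_c fixed_D q2q2 q2q)
      hence 3: "c * v + D * w = 0" using 2 zero by simp
      \<comment> \<open>The multipliers \<open>c ^ 2\<close>, \<open>- c * D\<close>,
        \<open>D ^ 2\<close> are the cofactors of the column of \<open>w\<close>.\<close>
      have "(c ^ 3 + D ^ 3) * w = c ^ 2 * (c * w + D * u) - c * D * (c * u + D * v) + D ^ 2 * (c * v + D * w)"
        by (simp add: algebra_simps power2_eq_square power3_eq_cube)
      thus "w = 0" using 1 2 3 det by simp
    qed
  next
    assume inj: "\<forall>w. M w = 0 \<longrightarrow> w = 0"
    show "c ^ 3 + D ^ 3 \<noteq> 0"
    proof
      assume det: "c ^ 3 + D ^ 3 = 0"
      \<comment> \<open>Otherwise \<open>M\<close> is zero. So \<open>c ^ 2\<close> or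
        \<open>D ^ 2\<close> is a nonzero coefficient of the trinomial.\<close>
      have "c \<noteq> 0 \<or> D \<noteq> 0" using inj[rule_format, of 1] by (auto simp: M_def)
      moreover have "q < q ^ 2" "q ^ 2 < q ^ 3"
        using q1 by (simp_all add: power_strict_increasing power2_eq_square power3_eq_cube)
      ultimately obtain u where u: "c ^ 2 * u + D ^ 2 * u ^ q + (- c * D) * u ^ (q ^ 2) \<noteq> 0"
        using trinomial_nonvanishing[of q "q ^ 2" "c ^ 2" "D ^ 2" "- c * D"] q1 assms(3) by auto
      define v where "v = c ^ 2 * u + D ^ 2 * u ^ q + (- c * D) * u ^ (q ^ 2)"
      \<comment> \<open>\<open>v\<close> comes from \<open>c\<^sup>3 + D\<^sup>3\<sigma>\<^sup>3 = (c + D\<sigma>)(c\<^sup>2 - cD\<sigma> + D\<^sup>2\<sigma>\<^sup>2)\<close> with \<open>\<sigma> w = w\<^bsup>q\<^sup>2\<^esup>\<close>.\<close>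
      have "v + c * D * u ^ (q ^ 2) = c ^ 2 * u + D ^ 2 * u ^ q"
        by (simp add: v_def)
      hence "(v + c * D * u ^ (q ^ 2)) ^ (q ^ 2) = (c ^ 2 * u + D ^ 2 * u ^ q) ^ (q ^ 2)"
        by simp
      hence "v ^ (q ^ 2) + c * D * u ^ q = c ^ 2 * u ^ (q ^ 2) + D ^ 2 * u"
        by (simp add: add power_mult_distrib fixed_c fixed_D q2q2 q2q
              power2_eq_square[of c] power2_eq_square[of D])
      hence "v ^ (q ^ 2) = c ^ 2 * u ^ (q ^ 2) + D ^ 2 * u - c * D * u ^ q"
        by (simp add: algebra_simps)
      hence "M v = c * v + D * (c ^ 2 * u ^ (q ^ 2) + D ^ 2 * u - c * D * u ^ q)"
        by (simp only: M_def)
      also have "\<dots> = (c ^ 3 + D ^ 3) * u"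
        by (simp add: v_def algebra_simps power2_eq_square power3_eq_cube)
      finally have "v = 0" using inj det by simp
      thus False using u v_def by simp
    qed
  qed
  \<comment> \<open>The factors are \<open>c + D = E\<close> and
    \<open>c ^ 2 - c * D + D ^ 2 = \<omega>\<close>.\<close>
  also have "c ^ 3 + D ^ 3 = E * \<omega>"
    unfolding c_def assms(8) by (simp add: algebra_simps power2_eq_square power3_eq_cube)
  finally show ?thesis .
qed

end
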